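(* Suppose that $n\ge 3$ and that $A\in M_n(\mathbb{R}_+)$ is the Toeplitz matrix \[ A=\left[\begin{array}{cccccc} a_{0} & a_{-1} & a_{-2} & \cdots & a_{-(n-2)} & 0\\ a_{1} & a_{0} & a_{-1} & \ddots & & a_{-(n-2)}\\ a_{2} & a_{1} & \ddots & \ddots & \ddots & \vdots\\ \vdots & \ddots & \ddots & \ddots & a_{-1} & a_{-2}\\ a_{n-2} & & \ddots & a_{1} & a_{0} & a_{-1}\\ 0 & a_{n-2} & \cdots & a_{2} & a_{1} & a_{0} \end{array}\right], \] that is, the $(i,j)$ entry of $A$ is $a_{i-j}$ whenever $|i-j|\le n-2$, and the $(1,n)$ and $(n,1)$ entries are $0$, where $a_i\neq 0$ for all $-(n-2)\le i\le n-2$. Then \[ \Lambda_1^{\max}(A)=\Bigl[a_0,\ \max_{-(n-2)\le i\le n-2}a_i\Bigr],\qquad \Lambda_2^{\max}(A)=\{a_0\}, \] and \[ \Lambda_k^{\max}(A)=\emptyset\quad\text{for all } 3\le k\le n. \]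
   Context: $\mathbb{R}_+=[0,\infty)$, and $M_{m\times n}(\mathbb{R}_+)$ is the set of $m\times n$ matrices with entries in $\mathbb{R}_+$; $M_n(\mathbb{R}_+)=M_{n\times n}(\mathbb{R}_+)$. The max algebra product is $(A\otimes B)_{ij}=\max_{k}a_{ik}b_{kj}$; $X^t$ is the transpose and $I_k$ the $k\times k$ identity matrix. For $1\le k\le n$, $\mathcal{X}_{n\times k}=\{X\in M_{n\times k}(\mathbb{R}_+): X^t\otimes X=I_k\}$. For $A\in M_n(\mathbb{R}_+)$ and $1\le k\le n$, the max rank-$k$ numerical range is \[ \Lambda_k^{\max}(A)=\{\lambda\in\mathbb{R}_+: X^t\otimes A\otimes X=\lambda I_k\ \text{for some } X\in\mathcal{X}_{n\times k}\}. \] *)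

theory Defs
  imports Complex_Main "Jordan_Normal_Form.Matrix"
begin

definition nonneg_mats :: "nat \<Rightarrow> nat \<Rightarrow> real mat set" where
  "nonneg_mats m n = {A \<in> carrier_mat m n. \<forall>i<m. \<forall>j<n. A $$ (i,j) \<ge> 0}"

text \<open>
  \<^const>\<open>Max\<close> is unspecified on the empty set, so the product is meaningful only if the inner
  dimension is positive.
\<close>

definition max_mult :: "real mat \<Rightarrow> real mat \<Rightarrow> real mat" (infixl "\<otimes>\<^sub>m" 70) where
  "A \<otimes>\<^sub>m B = mat (dim_row A) (dim_col B)
     (\<lambda>(i,j). Max ((\<lambda>k. A $$ (i,k) * B $$ (k,j)) ` {..<dim_col A}))"

definition max_isometries :: "nat \<Rightarrow> nat \<Rightarrow> real mat set" where
  "max_isometries n k = {X \<in> nonneg_mats n k. transpose_mat X \<otimes>\<^sub>m X = 1\<^sub>m k}"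

text \<open>Intended for square \<open>A\<close> of size \<open>n\<close> and \<open>1 \<le> k \<le> n\<close>.\<close>

definition max_rank_num_range :: "nat \<Rightarrow> real mat \<Rightarrow> real set" where
  "max_rank_num_range k A =
     {l. l \<ge> 0 \<and> (\<exists>X \<in> max_isometries (dim_row A) k. transpose_mat X \<otimes>\<^sub>m A \<otimes>\<^sub>m X = l \<cdot>\<^sub>m 1\<^sub>m k)}"

end

theory Submission
  imports Defs
begin

text \<open>
  The columns of a max isometry have pairwise disjoint supports and contain an entry 1. If the
  \<open>(p,q)\<close> entry of \<open>X\<^sup>t \<otimes> A \<otimes> X\<close> vanishes for \<open>p \<noteq> q\<close>, then \<open>A\<close> vanishes on the product of the two
  supports; as the only zeros of \<open>A\<close> are the two corners, these supports are the two singletons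
  belonging to the first and the last index. Hence \<open>k \<le> 2\<close>, and \<open>k = 2\<close> forces the diagonal value
  \<open>a\<^sub>0\<close>. For \<open>k = 1\<close>, the vectors \<open>e\<^sub>i + t e\<^sub>j\<close> with \<open>0 \<le> t \<le> 1\<close>, where the \<open>(i,j)\<close> entry of \<open>A\<close> is
  maximal, realise the whole interval.
\<close>

section \<open>Entries of max algebra products\<close>

lemma index_max_mult:
  assumes "i < dim_row A" "j < dim_col B"
  shows "(A \<otimes>\<^sub>m B) $$ (i,j) = Max ((\<lambda>k. A $$ (i,k) * B $$ (k,j)) ` {..<dim_col A})"
  using assms by (simp add: max_mult_def)

lemma dim_max_mult [simp]:
  "dim_row (A \<otimes>\<^sub>m B) = dim_row A" "dim_col (A \<otimes>\<^sub>m B) = dim_col B"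
  by (simp_all add: max_mult_def)

lemma Max_image_eq_iff:
  fixes f :: "'a \<Rightarrow> 'b :: linorder"
  assumes "finite S" "S \<noteq> {}"
  shows "Max (f ` S) = m \<longleftrightarrow> (\<exists>s\<in>S. f s = m) \<and> (\<forall>s\<in>S. f s \<le> m)"
  using assms by (subst Max_eq_iff) auto

lemma Max_eq_0_iff:
  fixes f :: "'a \<Rightarrow> real"
  assumes "finite S" "S \<noteq> {}" "\<And>s. s \<in> S \<Longrightarrow> f s \<ge> 0"
  shows "Max (f ` S) = 0 \<longleftrightarrow> (\<forall>s\<in>S. f s = 0)"
  unfolding Max_image_eq_iff[OF assms(1,2)] using assms by (metis all_not_in_conv antisym)

text \<open>Scaling by a nonnegative constant is monotone, so a maximiser stays a maximiser. Used to
  move the last factor of a triple product inside the inner maximum.\<close>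

lemma Max_image_mult_right:
  fixes f :: "'a \<Rightarrow> real"
  assumes "finite S" "S \<noteq> {}" "c \<ge> 0"
  shows "Max (f ` S) * c = Max ((\<lambda>s. f s * c) ` S)"
proof -
  have "Max (f ` S) \<in> f ` S" using assms by (intro Max_in) auto
  then obtain s where s: "s \<in> S" "Max (f ` S) = f s" by (rule imageE)
  have "\<forall>r\<in>S. f r \<le> Max (f ` S)" using assms by simp
  then show ?thesis
    using assms s by (subst eq_commute, subst Max_image_eq_iff) (auto intro: mult_right_mono)
qed

text \<open>Nonnegativity of column \<open>q\<close> lets \<open>X $$ (j,q)\<close> distribute over
  the inner maximum, and the two nested maxima merge into one over index pairs. The condition
  \<open>n > 0\<close> keeps every \<open>Max\<close> on a nonempty set.\<close>

lemma index_max_congruence: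
  assumes X: "X \<in> nonneg_mats n k" and A: "A \<in> carrier_mat n n" and n: "n > 0"
    and pq: "p < k" "q < k"
  shows "(transpose_mat X \<otimes>\<^sub>m A \<otimes>\<^sub>m X) $$ (p,q) =
    Max ((\<lambda>(i,j). X $$ (i,p) * A $$ (i,j) * X $$ (j,q)) ` ({..<n} \<times> {..<n}))"
proof -
  have dX: "dim_row X = n" "dim_col X = k" and X0: "\<And>i. i < n \<Longrightarrow> X $$ (i,q) \<ge> 0"
    using X pq by (auto simp: nonneg_mats_def)
  have dA: "dim_row A = n" "dim_col A = n" using A by auto
  define f where "f i j = X $$ (i,p) * A $$ (i,j) * X $$ (j,q)" for i j
  have ne: "{..<n} \<noteq> {}" using n by auto
  have "(transpose_mat X \<otimes>\<^sub>m A \<otimes>\<^sub>m X) $$ (p,q) =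
      Max ((\<lambda>j. Max ((\<lambda>i. X $$ (i,p) * A $$ (i,j)) ` {..<n}) * X $$ (j,q)) ` {..<n})"
    using dX dA pq by (simp add: index_max_mult cong: image_cong_simp)
  also have "\<dots> = Max ((\<lambda>j. Max ((\<lambda>i. f i j) ` {..<n})) ` {..<n})"
    unfolding f_def using X0 ne
    by (intro arg_cong[where f = Max] image_cong refl) (simp add: Max_image_mult_right)
  also have "\<dots> = Max ((\<lambda>(i,j). f i j) ` ({..<n} \<times> {..<n}))" (is "_ = ?M")
  proof -
    have le: "f i j \<le> ?M" if "i < n" "j < n" for i j
      using that by (intro Max_ge) auto
    have "?M \<in> (\<lambda>(i,j). f i j) ` ({..<n} \<times> {..<n})"
      using n by (intro Max_in) auto
    then obtain i j where ij: "i < n" "j < n" "f i j = ?M"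
      by (elim imageE) auto
    have "Max ((\<lambda>i. f i j) ` {..<n}) = ?M"
      using ij le by (subst Max_image_eq_iff[OF _ ne]) auto
    then show ?thesis
      using ij le ne by (subst Max_image_eq_iff[OF _ ne]) auto
  qed
  finally show ?thesis by (simp add: f_def)
qed

lemma nonneg_mats_carrier: "A \<in> nonneg_mats m n \<Longrightarrow> A \<in> carrier_mat m n"
  by (simp add: nonneg_mats_def)

text \<open>A diagonal entry of the product is a maximum of squares, and for nonnegative
  \<open>x\<close> both \<open>x^2 = 1\<close> and \<open>x^2 \<le> 1\<close> pass to
  \<open>x\<close>. An off-diagonal entry is a maximum of nonnegative products, so it vanishes only
  if every product does.\<close>

lemma max_isometries_iff:
  assumes n: "n > 0"
  shows "X \<in> max_isometries n k \<longleftrightarrow> X \<in> nonneg_mats n k \<and>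
    (\<forall>p<k. \<exists>i<n. X $$ (i,p) = 1) \<and> (\<forall>p<k. \<forall>i<n. X $$ (i,p) \<le> 1) \<and>
    (\<forall>p<k. \<forall>q<k. p \<noteq> q \<longrightarrow> (\<forall>i<n. X $$ (i,p) = 0 \<or> X $$ (i,q) = 0))"
proof (cases "X \<in> nonneg_mats n k")
  case X: True
  have dX: "dim_row X = n" "dim_col X = k" and X0: "\<And>i p. i < n \<Longrightarrow> p < k \<Longrightarrow> X $$ (i,p) \<ge> 0"
    using X by (auto simp: nonneg_mats_def)
  have ne: "{..<n} \<noteq> {}" using n by auto
  define G where "G p q = Max ((\<lambda>i. X $$ (i,p) * X $$ (i,q)) ` {..<n})" for p q
  have "transpose_mat X \<otimes>\<^sub>m X = 1\<^sub>m k \<longleftrightarrow> (\<forall>p<k. \<forall>q<k. G p q = (if p = q then 1 else 0))"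
    using dX by (auto simp: mat_eq_iff index_max_mult G_def cong: image_cong_simp)
  also have "\<dots> \<longleftrightarrow> (\<forall>p<k. G p p = 1) \<and> (\<forall>p<k. \<forall>q<k. p \<noteq> q \<longrightarrow> G p q = 0)"
    by auto
  finally have 1: "transpose_mat X \<otimes>\<^sub>m X = 1\<^sub>m k \<longleftrightarrow> \<dots>" .
  have 2: "G p p = 1 \<longleftrightarrow> (\<exists>i<n. X $$ (i,p) = 1) \<and> (\<forall>i<n. X $$ (i,p) \<le> 1)" if "p < k" for p
  proof -
    have "X $$ (i,p) * X $$ (i,p) = 1 \<longleftrightarrow> X $$ (i,p) = 1"
      "X $$ (i,p) * X $$ (i,p) \<le> 1 \<longleftrightarrow> X $$ (i,p) \<le> 1" if "i < n" for i
      using X0[OF that \<open>p < k\<close>] by (auto simp: abs_square_eq_1 abs_square_le_1 simp flip: power2_eq_square)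
    then show ?thesis
      unfolding G_def Max_image_eq_iff[OF finite_lessThan ne] by auto
  qed
  have 3: "G p q = 0 \<longleftrightarrow> (\<forall>i<n. X $$ (i,p) = 0 \<or> X $$ (i,q) = 0)" if "p < k" "q < k" for p q
    unfolding G_def using X0 that by (subst Max_eq_0_iff[OF finite_lessThan ne]) auto
  show ?thesis
    by (simp add: 1 2 3 X max_isometries_def all_conj_distrib imp_conjR cong: imp_cong)
qed (simp add: max_isometries_def)

text \<open>Removes \<open>Max\<close> from the defining equation: on the diagonal, \<open>l\<close>
  is an attained upper bound; off the diagonal, a zero maximum of nonnegative terms kills each
  term.\<close>

lemma max_rank_num_range_iff:
  assumes n: "n > 0" and A: "A \<in> nonneg_mats n n"
  shows "l \<in> max_rank_num_range k A \<longleftrightarrow> l \<ge> 0 \<and> (\<exists>X \<in> max_isometries n k.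
    (\<forall>p<k. (\<exists>i<n. \<exists>j<n. X $$ (i,p) * A $$ (i,j) * X $$ (j,p) = l) \<and>
           (\<forall>i<n. \<forall>j<n. X $$ (i,p) * A $$ (i,j) * X $$ (j,p) \<le> l)) \<and>
    (\<forall>p<k. \<forall>q<k. p \<noteq> q \<longrightarrow>
      (\<forall>i<n. \<forall>j<n. X $$ (i,p) = 0 \<or> A $$ (i,j) = 0 \<or> X $$ (j,q) = 0)))"
proof -
  have cA: "A \<in> carrier_mat n n" by (rule nonneg_mats_carrier[OF A])
  have dA: "dim_row A = n" using cA by simp
  have A0: "\<And>i j. i < n \<Longrightarrow> j < n \<Longrightarrow> A $$ (i,j) \<ge> 0" using A by (auto simp: nonneg_mats_def)
  have ne: "{..<n} \<times> {..<n} \<noteq> {}" and fin: "finite ({..<n} \<times> {..<n})" using n by auto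
  have "transpose_mat X \<otimes>\<^sub>m A \<otimes>\<^sub>m X = l \<cdot>\<^sub>m 1\<^sub>m k \<longleftrightarrow>
    (\<forall>p<k. (\<exists>i<n. \<exists>j<n. X $$ (i,p) * A $$ (i,j) * X $$ (j,p) = l) \<and>
           (\<forall>i<n. \<forall>j<n. X $$ (i,p) * A $$ (i,j) * X $$ (j,p) \<le> l)) \<and>
    (\<forall>p<k. \<forall>q<k. p \<noteq> q \<longrightarrow>
      (\<forall>i<n. \<forall>j<n. X $$ (i,p) = 0 \<or> A $$ (i,j) = 0 \<or> X $$ (j,q) = 0))"
    (is "_ \<longleftrightarrow> ?R") if "X \<in> max_isometries n k" for X
  proof -
    have X: "X \<in> nonneg_mats n k" using that by (simp add: max_isometries_def)
    then have dX: "dim_row X = n" "dim_col X = k"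
      and X0: "\<And>i p. i < n \<Longrightarrow> p < k \<Longrightarrow> X $$ (i,p) \<ge> 0"
      by (auto simp: nonneg_mats_def)
    define M where
      "M p q = Max ((\<lambda>(i,j). X $$ (i,p) * A $$ (i,j) * X $$ (j,q)) ` ({..<n} \<times> {..<n}))" for p q
    have "transpose_mat X \<otimes>\<^sub>m A \<otimes>\<^sub>m X = l \<cdot>\<^sub>m 1\<^sub>m k \<longleftrightarrow>
        (\<forall>p<k. \<forall>q<k. M p q = (if p = q then l else 0))"
      using dX by (auto simp: mat_eq_iff index_max_congruence[OF X cA n] M_def)
    also have "\<dots> \<longleftrightarrow> (\<forall>p<k. M p p = l) \<and> (\<forall>p<k. \<forall>q<k. p \<noteq> q \<longrightarrow> M p q = 0)"
      by auto
    finally have 1: "transpose_mat X \<otimes>\<^sub>m A \<otimes>\<^sub>m X = l \<cdot>\<^sub>m 1\<^sub>m k \<longleftrightarrow> \<dots>" .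
    have 2: "M p p = l \<longleftrightarrow> (\<exists>i<n. \<exists>j<n. X $$ (i,p) * A $$ (i,j) * X $$ (j,p) = l) \<and>
           (\<forall>i<n. \<forall>j<n. X $$ (i,p) * A $$ (i,j) * X $$ (j,p) \<le> l)" for p
      unfolding M_def Max_image_eq_iff[OF fin ne] by (auto simp: Bex_def)
    have 3: "M p q = 0 \<longleftrightarrow>
        (\<forall>i<n. \<forall>j<n. X $$ (i,p) = 0 \<or> A $$ (i,j) = 0 \<or> X $$ (j,q) = 0)"
      if "p < k" "q < k" for p q
      unfolding M_def using X0 A0 that by (subst Max_eq_0_iff[OF fin ne]) auto
    show ?thesis
      by (simp add: 1 2 3)
  qed
  then show ?thesis
    unfolding max_rank_num_range_def mem_Collect_eq dA by (intro conj_cong bex_cong refl) simp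
qed

theorem theorem2p7:
  fixes n :: nat and A :: "real mat" and a :: "int \<Rightarrow> real"
  assumes "n \<ge> 3"
    and "A \<in> nonneg_mats n n"
    and "\<And>i j. i < n \<Longrightarrow> j < n \<Longrightarrow> \<bar>int i - int j\<bar> \<le> int n - 2 \<Longrightarrow> A $$ (i,j) = a (int i - int j)"
    and "A $$ (0, n - 1) = 0"
    and "A $$ (n - 1, 0) = 0"
    and "\<And>i. i \<in> {- (int n - 2)..int n - 2} \<Longrightarrow> a i \<noteq> 0"
  shows "max_rank_num_range 1 A = {a 0..Max (a ` {- (int n - 2)..int n - 2})}
    \<and> max_rank_num_range 2 A = {a 0}
    \<and> (\<forall>k. 3 \<le> k \<and> k \<le> n \<longrightarrow> max_rank_num_range k A = {})"
proof -
  note n = assms(1) and toep = assms(3)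
  have n0: "n > 0" using n by simp
  note range_iff = max_rank_num_range_iff[OF n0 assms(2)] and iso_iff = max_isometries_iff[OF n0]
  define D where "D = {- (int n - 2)..int n - 2}"
  define M where "M = Max (a ` D)"
  have A0: "A $$ (i,j) \<ge> 0" if "i < n" "j < n" for i j
    using assms(2) that by (auto simp: nonneg_mats_def)
  have diag: "A $$ (i,i) = a 0" if "i < n" for i
    using toep[of i i] that n by simp
  have a0: "a 0 > 0"
    using A0[of 0 0] diag[of 0] assms(6)[of 0] n by auto
  have a0M: "a 0 \<le> M"
    unfolding M_def D_def using n by (intro Max_ge) auto
  \<comment> \<open>For indices below \<open>n\<close>, a difference outside \<open>D\<close> must
    be \<open>n - 1\<close> or \<open>- (n - 1)\<close>, which occurs only at a corner.\<close>
  have corner: "(i = 0 \<and> j = n - 1) \<or> (i = n - 1 \<and> j = 0) \<or>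
      int i - int j \<in> D \<and> A $$ (i,j) = a (int i - int j) \<and> A $$ (i,j) \<noteq> 0"
    if "i < n" "j < n" for i j
  proof (cases "int i - int j \<in> D")
    case True
    then have "\<bar>int i - int j\<bar> \<le> int n - 2" by (auto simp: D_def)
    then show ?thesis using True toep[OF that] assms(6) unfolding D_def by metis
  next
    case False
    then show ?thesis using that by (auto simp: D_def)
  qed
  have AM: "A $$ (i,j) \<le> M" if "i < n" "j < n" for i j
  proof -
    have "a d \<le> M" if "d \<in> D" for d
      unfolding M_def using that by (intro Max_ge) (auto simp: D_def)
    \<comment> \<open>The zero corners are not values of \<open>a\<close> on \<open>D\<close>, so
      they need this separate bound.\<close>
    moreover have "M \<ge> 0" using a0 a0M by simp
    ultimately show ?thesis using corner[OF that] assms(4,5) by metis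
  qed
  \<comment> \<open>The index \<open>e\<close> records which corner is met: one column lives at
    \<open>e\<close>, the other at the opposite end \<open>n - 1 - e\<close>.\<close>
  have opposite: "\<exists>e. (e = 0 \<or> e = n - 1) \<and> (\<forall>i<n. X $$ (i,p) \<noteq> 0 \<longleftrightarrow> i = e) \<and>
      (\<forall>i<n. X $$ (i,q) \<noteq> 0 \<longleftrightarrow> i = n - 1 - e)"
    if X: "X \<in> max_isometries n k" and pq: "p < k" "q < k" "p \<noteq> q"
      and off: "\<forall>i<n. \<forall>j<n. X $$ (i,p) = 0 \<or> A $$ (i,j) = 0 \<or> X $$ (j,q) = 0" for X k p q
  proof -
    obtain i j where i: "i < n" "X $$ (i,p) = 1" and j: "j < n" "X $$ (j,q) = 1"
      using X pq unfolding iso_iff by metis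
    have *: "(i' = 0 \<and> j' = n - 1) \<or> (i' = n - 1 \<and> j' = 0)"
      if "i' < n" "j' < n" "X $$ (i',p) \<noteq> 0" "X $$ (j',q) \<noteq> 0" for i' j'
      using corner[OF that(1,2)] off that by blast
    have "(i = 0 \<and> j = n - 1) \<or> (i = n - 1 \<and> j = 0)" using *[of i j] i j by simp
    then have ij: "i = 0 \<or> i = n - 1" "j = n - 1 - i" by auto
    \<comment> \<open>Pairing \<open>i'\<close> with the fixed \<open>j\<close> gives a corner
      again, and a corner is determined by either coordinate because
      \<open>0 \<noteq> n - 1\<close>.\<close>
    have supp_p: "i' = i" if "i' < n" "X $$ (i',p) \<noteq> 0" for i'
      using *[of i j] *[of i' j] i j that n by auto
    have supp_q: "j' = j" if "j' < n" "X $$ (j',q) \<noteq> 0" for j'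
      using *[of i j] *[of i j'] i j that n by auto
    have "\<forall>i'<n. X $$ (i',p) \<noteq> 0 \<longleftrightarrow> i' = i" using i supp_p by (metis zero_neq_one)
    moreover have "\<forall>j'<n. X $$ (j',q) \<noteq> 0 \<longleftrightarrow> j' = j" using j supp_q by (metis zero_neq_one)
    ultimately show ?thesis using ij by blast
  qed

  \<comment> \<open>Rank one: the interval\<close>
  have "l \<in> {a 0..M}" if l: "l \<in> max_rank_num_range 1 A" for l
  proof -
    obtain X where X: "X \<in> max_isometries n 1"
      and att: "\<exists>i<n. \<exists>j<n. X $$ (i,0) * A $$ (i,j) * X $$ (j,0) = l"
      and le: "\<forall>i<n. \<forall>j<n. X $$ (i,0) * A $$ (i,j) * X $$ (j,0) \<le> l"
      using l unfolding range_iff by auto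
    obtain s where s: "s < n" "X $$ (s,0) = 1"
      using X unfolding iso_iff by auto
    have X01: "X $$ (i,0) \<ge> 0" "X $$ (i,0) \<le> 1" if "i < n" for i
      using X that unfolding iso_iff by (auto simp: nonneg_mats_def)
    obtain i j where ij: "i < n" "j < n" "X $$ (i,0) * A $$ (i,j) * X $$ (j,0) = l"
      using att by blast
    have "X $$ (i,0) * A $$ (i,j) * X $$ (j,0) \<le> 1 * M * 1"
      using ij X01 A0 AM a0 a0M by (intro mult_mono) auto
    \<comment> \<open>The lower bound comes from the term at \<open>(s,s)\<close>, which equals
      \<open>a 0\<close>.\<close>
    then show ?thesis
      using le[rule_format, of s s] s ij diag[of s] by simp
  qed
  moreover have "l \<in> max_rank_num_range 1 A" if l: "l \<in> {a 0..M}" for l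
  proof -
    have "M \<in> a ` D" unfolding M_def using n by (intro Max_in) (auto simp: D_def)
    then obtain d where d: "d \<in> D" "M = a d" by auto
    \<comment> \<open>Positive and negative parts of \<open>d\<close>: their difference is
      \<open>d\<close>, and both are at most \<open>n - 2\<close>.\<close>
    define i where "i = nat (max 0 d)"
    define j where "j = nat (max 0 (- d))"
    have ij: "i < n" "j < n" "int i - int j = d"
      using d n by (auto simp: i_def j_def D_def max_def)
    have Aij: "A $$ (i,j) = M"
      using toep[of i j] ij d by (auto simp: D_def)
    \<comment> \<open>Makes the term at \<open>(i,j)\<close> equal to \<open>1 * M * t = l\<close>;
      here \<open>M \<ge> a 0 > 0\<close>, and \<open>l \<le> M\<close> gives
      \<open>t \<le> 1\<close>.\<close>
    define t where "t = l / M"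
    have t: "t \<ge> 0" "t \<le> 1" "t * M = l"
      using l a0 a0M by (auto simp: t_def divide_simps)
    \<comment> \<open>If \<open>d = 0\<close>, then \<open>i = j\<close>; the first test wins and
      the column is a plain unit vector.\<close>
    define X where "X = mat n 1 (\<lambda>(r,_). if r = i then 1 else if r = j then t else 0)"
    have Xr: "X $$ (r,0) = (if r = i then 1 else if r = j then t else 0)" if "r < n" for r
      using that by (simp add: X_def)
    have X: "X \<in> max_isometries n 1"
      unfolding iso_iff using ij t by (auto simp: X_def nonneg_mats_def)
    have upper: "X $$ (r,0) * A $$ (r,s) * X $$ (s,0) \<le> l" if "r < n" "s < n" for r s
    proof (cases "r = s")
      case True
      have "X $$ (r,0) * X $$ (r,0) \<le> 1"
        using Xr[OF \<open>r < n\<close>] t by (auto simp: mult_le_one)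
      then have "a 0 * (X $$ (r,0) * X $$ (r,0)) \<le> a 0"
        using a0 by (intro mult_left_le) auto
      then show ?thesis
        using True diag[OF \<open>r < n\<close>] l by (simp add: algebra_simps)
    next
      case False
      \<comment> \<open>A nonzero term with \<open>r \<noteq> s\<close> uses the two indices
        \<open>i\<close> and \<open>j\<close> once each, hence exactly one factor
        \<open>t\<close>.\<close>
      have "t * A $$ (r,s) \<le> l"
        using t AM[OF that] by (metis mult_left_mono)
      moreover have "l \<ge> 0" using l a0 by simp
      ultimately show ?thesis
        using False Xr[OF that(1)] Xr[OF that(2)] by (auto simp: mult.commute)
    qed
    have att: "\<exists>r<n. \<exists>s<n. X $$ (r,0) * A $$ (r,s) * X $$ (s,0) = l"
    proof (cases "i = j")
      case True
      \<comment> \<open>The maximum sits on the diagonal here, so \<open>M = a 0\<close> and the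
        interval is a single point.\<close>
      then have "M = l" using Aij diag ij l a0M by auto
      then show ?thesis using True ij Aij Xr by (intro exI[of _ i] conjI) auto
    next
      case False
      then show ?thesis
        using ij Aij Xr t by (intro exI[of _ i] conjI exI[of _ j]) (auto simp: mult.commute)
    qed
    show ?thesis
      unfolding range_iff using X upper att l a0 by (intro conjI bexI[of _ X]) auto
  qed
  ultimately have rank1: "max_rank_num_range 1 A = {a 0..M}" by blast

  \<comment> \<open>Rank two: the single value\<close>
  have "l = a 0" if l: "l \<in> max_rank_num_range 2 A" for l
  proof -
    obtain X where X: "X \<in> max_isometries n 2"
      and att: "\<exists>i<n. \<exists>j<n. X $$ (i,0) * A $$ (i,j) * X $$ (j,0) = l"
      and le: "\<forall>i<n. \<forall>j<n. X $$ (i,0) * A $$ (i,j) * X $$ (j,0) \<le> l"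
      and off: "\<forall>i<n. \<forall>j<n. X $$ (i,0) = 0 \<or> A $$ (i,j) = 0 \<or> X $$ (j,1) = 0"
      using l unfolding range_iff by force
    obtain e where e: "e = 0 \<or> e = n - 1" "\<forall>i<n. X $$ (i,0) \<noteq> 0 \<longleftrightarrow> i = e"
      using opposite[OF X _ _ _ off] by auto
    have "e < n" using e n by auto
    have "X $$ (e,0) = 1" using X e unfolding iso_iff by (metis zero_less_numeral zero_neq_one)
    then have ee: "X $$ (e,0) * A $$ (e,e) * X $$ (e,0) = a 0" using diag[OF \<open>e < n\<close>] by simp
    then have "a 0 \<le> l" using le \<open>e < n\<close> by metis
    \<comment> \<open>A term attaining a nonzero \<open>l\<close> has both indices in the support of
      column 0, so it is the term at \<open>(e,e)\<close>.\<close>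
    then have "l \<noteq> 0" using a0 by simp
    then show ?thesis using att e(2) ee by fastforce
  qed
  moreover have "a 0 \<in> max_rank_num_range 2 A"
  proof -
    \<comment> \<open>The columns are the first and last unit vectors: only a corner of
      \<open>A\<close> can enter an off-diagonal entry of the congruence.\<close>
    define X where "X = mat n 2 (\<lambda>(r,p). if r = (if p = 0 then 0 else n - 1) then 1 else (0::real))"
    have Xr: "X $$ (r,p) = (if r = (if p = 0 then 0 else n - 1) then 1 else 0)"
      if "r < n" "p < 2" for r p
      using that by (simp add: X_def)
    have X: "X \<in> max_isometries n 2"
      unfolding iso_iff
    proof (intro conjI allI impI)
      show "X \<in> nonneg_mats n 2" by (auto simp: X_def nonneg_mats_def)
      show "\<exists>i<n. X $$ (i,p) = 1" if "p < 2" for p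
        using that n Xr by (intro exI[of _ "if p = 0 then 0 else n - 1"]) auto
      show "X $$ (i,p) \<le> 1" if "p < 2" "i < n" for p i
        using that Xr by auto
      show "X $$ (i,p) = 0 \<or> X $$ (i,q) = 0" if "p < 2" "q < 2" "p \<noteq> q" "i < n" for p q i
        using that Xr n by (auto simp: less_2_cases_iff)
    qed
    show ?thesis
      unfolding range_iff
    proof (intro conjI bexI[OF _ X] allI impI)
      show "0 \<le> a 0" using a0 by simp
      show "\<exists>i<n. \<exists>j<n. X $$ (i,p) * A $$ (i,j) * X $$ (j,p) = a 0" if "p < 2" for p
        using that n Xr diag
        by (intro exI[of _ "if p = 0 then 0 else n - 1"] conjI) auto
      show "X $$ (i,p) * A $$ (i,j) * X $$ (j,p) \<le> a 0" if "p < 2" "i < n" "j < n" for p i j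
        using that Xr diag a0 by auto
      show "X $$ (i,p) = 0 \<or> A $$ (i,j) = 0 \<or> X $$ (j,q) = 0"
        if "p < 2" "q < 2" "p \<noteq> q" "i < n" "j < n" for p q i j
        using that Xr assms(4,5) by (auto simp: less_2_cases_iff)
    qed
  qed
  ultimately have rank2: "max_rank_num_range 2 A = {a 0}" by blast

  \<comment> \<open>Rank at least three: emptiness\<close>
  have "max_rank_num_range k A = {}" if k: "3 \<le> k" for k
  proof (rule ccontr)
    assume "max_rank_num_range k A \<noteq> {}"
    then obtain l where "l \<in> max_rank_num_range k A" by blast
    then obtain X where X: "X \<in> max_isometries n k"
      and off: "\<forall>p<k. \<forall>q<k. p \<noteq> q \<longrightarrow>
        (\<forall>i<n. \<forall>j<n. X $$ (i,p) = 0 \<or> A $$ (i,j) = 0 \<or> X $$ (j,q) = 0)"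
      unfolding range_iff by (elim conjE bexE) (rule that)
    obtain e where e: "e = 0 \<or> e = n - 1" "\<forall>i<n. X $$ (i,0) \<noteq> 0 \<longleftrightarrow> i = e"
      "\<forall>i<n. X $$ (i,1) \<noteq> 0 \<longleftrightarrow> i = n - 1 - e"
      using opposite[OF X, of 0 1] off k by auto
    obtain f where f: "\<forall>i<n. X $$ (i,0) \<noteq> 0 \<longleftrightarrow> i = f"
      "\<forall>i<n. X $$ (i,2) \<noteq> 0 \<longleftrightarrow> i = n - 1 - f"
      using opposite[OF X, of 0 2] off k by auto
    \<comment> \<open>Both \<open>e\<close> and \<open>f\<close> are the only support index of
      column 0, so they agree; columns 1 and 2 then share the index \<open>n - 1 - e\<close>,
      against disjointness of supports.\<close>
    have "e < n" "n - 1 - e < n" using e n by auto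
    then have "X $$ (n - 1 - e, 1) \<noteq> 0" "X $$ (n - 1 - e, 2) \<noteq> 0" using e f by blast+
    moreover have "X $$ (n - 1 - e, 1) = 0 \<or> X $$ (n - 1 - e, 2) = 0"
      using X k \<open>n - 1 - e < n\<close> unfolding iso_iff by auto
    ultimately show False by blast
  qed
  then show ?thesis
    using rank1 rank2 by (simp add: M_def D_def)
qed

end
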